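(* Let $\beta^2=1-e^2$. Given $f$ and $g$ in $\mathcal P_2(\mathbb R^3)$ with equal mean velocity, one has $$W_2\big(\tilde Q_e^+(f,f),\tilde Q_e^+(g,g)\big)\le W_2(f,g).$$
   Context: $\mathcal P_2(\mathbb R^3)$ is the set of Borel probability measures on $\mathbb R^3$ with finite second moment (written as densities $f(v)\,dv$ even if not absolutely continuous). The mean velocity of $f$ is $\int v f(v)\,dv$. Let $0\le e\le 1$ and let $\eta$ be a real random variable with law a probability measure $\mu$ supported in $[-e,\infty)$, with $\langle\eta\rangle=0$ and $\langle\eta^2\rangle=\beta^2$, where $\langle\cdot\rangle$ denotes expectation with respect to $\eta$ (integration against $\mu$). Put $\tilde e=e+\eta\ge0$ (random restitution coefficient). For $v,w\in\mathbb R^3$, $\sigma\in S^2$, the post-collision velocity is $$v'=\tfrac12(v+w)+\tfrac{1-\tilde e}{4}(v-w)+\tfrac{1+\tilde e}{4}|v-w|\sigma .$$ The gain operator $\tilde Q_e^+(f,f)$ is the probability measure on $\mathbb R^3$ defined by $$(\varphi,\tilde Q_e^+(f,f))=\frac1{4\pi}\Big\langle\int_{\mathbb R^3}\int_{\mathbb R^3}\int_{S^2} f(v)f(w)\,\varphi(v')\,d\sigma\,dv\,dw\Big\rangle$$ for bounded continuous $\varphi$. The condition $\beta^2=1-e^2$ is the "conservative in the mean" case, in which $\langle |v'|^2+|w'|^2\rangle=|v|^2+|w|^2$ with $w'=v+w-v'$. $W_2(f,g)=\inf_{\Pi}\big(\iint |v-x|^2\,d\Pi(v,x)\big)^{1/2}$,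 the infimum being over all joint probability measures $\Pi$ with marginals $f$ and $g$. *)

theory Defs
  imports "HOL-Probability.Probability"
begin

section \<open>Probability measures and the Wasserstein distance\<close>

definition P2 :: "(real^3) measure set" where
  "P2 = {f. prob_space f \<and> sets f = sets borel \<and> integrable f (\<lambda>v. (norm v)\<^sup>2)}"

definition mean_velocity :: "(real^3) measure \<Rightarrow> real^3" where
  "mean_velocity f = (\<integral>v. v \<partial>f)"

definition couplings :: "(real^3) measure \<Rightarrow> (real^3) measure \<Rightarrow> ((real^3) \<times> (real^3)) measure set" where
  "couplings f g = {\<gamma>. prob_space \<gamma> \<and> sets \<gamma> = sets borel \<and>
     distr \<gamma> borel fst = f \<and> distr \<gamma> borel snd = g}"

definition ennreal_sqrt :: "ennreal \<Rightarrow> ennreal" where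
  "ennreal_sqrt x = (if x = \<infinity> then \<infinity> else ennreal (sqrt (enn2real x)))"

text \<open>The distance takes values in \<open>[0, \<infinity>]\<close>, so that a transport cost that is not integrable
  counts as infinite, and not as 0 as it would for a Bochner integral.\<close>

definition W2 :: "(real^3) measure \<Rightarrow> (real^3) measure \<Rightarrow> ennreal" where
  "W2 f g = (INF \<gamma>\<in>couplings f g. ennreal_sqrt (\<integral>\<^sup>+(v, x). ennreal ((norm (v - x))\<^sup>2) \<partial>\<gamma>))"


section \<open>Surface measure on the unit sphere\<close>

text \<open>The (unnormalised) surface measure on \<open>S\<^sup>2\<close>, as a measure on \<open>\<real>\<^sup>3\<close>: the image of
  \<open>sin \<theta> d\<theta> d\<phi>\<close> under spherical coordinates. Its total mass is \<open>4 \<pi>\<close>.\<close>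

definition sphere_point :: "real \<times> real \<Rightarrow> real^3" where
  "sphere_point = (\<lambda>(\<theta>, \<phi>). vector [sin \<theta> * cos \<phi>, sin \<theta> * sin \<phi>, cos \<theta>])"

definition sphere_measure :: "(real^3) measure" where
  "sphere_measure = distr
     (density lborel (\<lambda>(\<theta>, \<phi>). ennreal (sin \<theta>) * indicator ({0..pi} \<times> {0..2 * pi}) (\<theta>, \<phi>)))
     borel sphere_point"


section \<open>Collisions with random restitution coefficient\<close>

definition fluctuation_law :: "real \<Rightarrow> real \<Rightarrow> real measure \<Rightarrow> bool" where
  "fluctuation_law e \<beta> \<mu> \<longleftrightarrow> prob_space \<mu> \<and> sets \<mu> = sets borel \<and> (AE \<eta> in \<mu>. - e \<le> \<eta>) \<and>
     integrable \<mu> (\<lambda>\<eta>. \<eta>) \<and> (\<integral>\<eta>. \<eta> \<partial>\<mu>) = 0 \<and>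
     integrable \<mu> (\<lambda>\<eta>. \<eta>\<^sup>2) \<and> (\<integral>\<eta>. \<eta>\<^sup>2 \<partial>\<mu>) = \<beta>\<^sup>2"

text \<open>In \<open>post_velocity r v w \<sigma>\<close>, the argument \<open>r\<close> is the restitution coefficient.\<close>

definition post_velocity :: "real \<Rightarrow> real^3 \<Rightarrow> real^3 \<Rightarrow> real^3 \<Rightarrow> real^3" where
  "post_velocity r v w \<sigma> =
     (1 / 2) *\<^sub>R (v + w) + ((1 - r) / 4) *\<^sub>R (v - w) + ((1 + r) / 4 * norm (v - w)) *\<^sub>R \<sigma>"

definition is_gain ::
  "real \<Rightarrow> real measure \<Rightarrow> (real^3) measure \<Rightarrow> (real^3) measure \<Rightarrow> (real^3) measure \<Rightarrow> bool" where
  "is_gain e \<mu> f g Q \<longleftrightarrow> prob_space Q \<and> sets Q = sets borel \<and>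
     (\<forall>\<phi> :: real^3 \<Rightarrow> real. continuous_on UNIV \<phi> \<longrightarrow> bounded (range \<phi>) \<longrightarrow>
        (\<integral>u. \<phi> u \<partial>Q) =
        1 / (4 * pi) * (\<integral>\<eta>. (\<integral>v. (\<integral>w. (\<integral>\<sigma>. \<phi> (post_velocity (e + \<eta>) v w \<sigma>)
          \<partial>sphere_measure) \<partial>g) \<partial>f) \<partial>\<mu>))"

definition gain ::
  "real \<Rightarrow> real measure \<Rightarrow> (real^3) measure \<Rightarrow> (real^3) measure \<Rightarrow> (real^3) measure" where
  "gain e \<mu> f g = (THE Q. is_gain e \<mu> f g Q)"


section \<open>The gain operator is well defined\<close>

lemma sphere_point_measurable [measurable]: "sphere_point \<in> borel_measurable borel"
proof -
  have "continuous_on UNIV (\<lambda>p. vector [sin (fst p) * cos (snd p), sin (fst p) * sin (snd p), cos (fst p)] $ i :: real)"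
    for i :: 3
    using exhaust_3[of i]
    by (elim disjE) (simp_all add: vector_3 continuous_on_sin continuous_on_cos continuous_on_mult
      continuous_on_fst continuous_on_snd continuous_on_id)
  then have "continuous_on UNIV (\<lambda>p. \<chi> i. sphere_point p $ i)"
    unfolding sphere_point_def case_prod_beta by (rule continuous_on_vec_lambda)
  then have "continuous_on UNIV sphere_point"
    by simp
  then show ?thesis by (rule borel_measurable_continuous_onI)
qed

lemma sets_sphere_measure [simp, measurable_cong]: "sets sphere_measure = sets borel"
  by (simp add: sphere_measure_def)

lemma space_sphere_measure [simp]: "space sphere_measure = UNIV"
  by (simp add: sphere_measure_def)

lemma emeasure_sphere_measure: "emeasure sphere_measure UNIV = ennreal (4 * pi)"
proof -
  have [measurable]: "(\<lambda>(\<theta>, \<phi>). ennreal (sin \<theta>) * indicator ({0..pi} \<times> {0..2 * pi}) (\<theta>, \<phi>))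
      \<in> borel_measurable (borel :: (real \<times> real) measure)"
    unfolding borel_prod[symmetric] by measurable
  have "emeasure sphere_measure UNIV
      = (\<integral>\<^sup>+p. (case p of (\<theta>, \<phi>) \<Rightarrow> ennreal (sin \<theta>) * indicator ({0..pi} \<times> {0..2 * pi}) (\<theta>, \<phi>))
           \<partial>(lborel \<Otimes>\<^sub>M lborel))"
    unfolding sphere_measure_def lborel_prod
    by (subst emeasure_distr) (simp_all add: emeasure_density)
  also have "\<dots> = (\<integral>\<^sup>+\<theta>. \<integral>\<^sup>+\<phi>. (ennreal (sin \<theta>) * indicator {0..pi} \<theta>) * indicator {0..2 * pi} (\<phi>::real)
       \<partial>lborel \<partial>lborel)"
    by (subst lborel.nn_integral_fst[symmetric])
       (auto intro!: nn_integral_cong simp: indicator_times mult.assoc)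
  also have "\<dots> = (\<integral>\<^sup>+\<theta>. (ennreal (sin \<theta>) * indicator {0..pi} \<theta>) * ennreal (2 * pi) \<partial>lborel)"
    by (subst nn_integral_cmult_indicator) auto
  also have "\<dots> = (\<integral>\<^sup>+\<theta>. ennreal (sin \<theta>) * indicator {0..pi} \<theta> \<partial>lborel) * ennreal (2 * pi)"
    by (rule nn_integral_multc) auto
  also have "(\<integral>\<^sup>+\<theta>. ennreal (sin \<theta>) * indicator {0..pi} \<theta> \<partial>lborel) = ennreal (- cos pi - (- cos 0))"
    by (rule nn_integral_FTC_Icc) (auto intro!: derivative_eq_intros sin_ge_zero)
  also have "\<dots> * ennreal (2 * pi) = ennreal (4 * pi)"
    by (subst ennreal_mult[symmetric]) simp_all
  finally show ?thesis .
qed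

lemma finite_measure_sphere_measure: "finite_measure sphere_measure"
  by (rule finite_measureI) (simp add: emeasure_sphere_measure)

lemma post_velocity_measurable:
  "(\<lambda>(\<eta>, v, w, \<sigma>). post_velocity (e + \<eta>) v w \<sigma>) \<in> borel_measurable borel"
  unfolding post_velocity_def case_prod_beta
  by (intro borel_measurable_continuous_onI continuous_intros) auto

lemma prob_measure_eqI_continuous:
  fixes M N :: "'a :: metric_space measure"
  assumes "prob_space M" "prob_space N" and M: "sets M = sets borel" and N: "sets N = sets borel"
    and eq: "\<And>\<phi> :: 'a \<Rightarrow> real. continuous_on UNIV \<phi> \<Longrightarrow> bounded (range \<phi>) \<Longrightarrow>
               (\<integral>x. \<phi> x \<partial>M) = (\<integral>x. \<phi> x \<partial>N)"
  shows "M = N"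
proof -
  interpret M: prob_space M by fact
  interpret N: prob_space N by fact
  have closed: "measure M C = measure N C" if C: "closed C" "C \<noteq> {}" for C
  proof -
    define \<phi> where "\<phi> n x = max 0 (1 - real n * infdist x C)" for n x
    have cont: "continuous_on UNIV (\<phi> n)" for n
      unfolding \<phi>_def by (intro continuous_intros)
    have bd: "\<bar>\<phi> n x\<bar> \<le> 1" for n x
      unfolding \<phi>_def by (auto simp: infdist_nonneg)
    have lim: "(\<lambda>n. \<phi> n x) \<longlonglongrightarrow> indicator C x" for x
    proof (cases "x \<in> C")
      case True
      then show ?thesis by (simp add: \<phi>_def)
    next
      case False
      then have pos: "infdist x C > 0" using infdist_pos_not_in_closed[OF C] by auto
      obtain m where m: "1 / infdist x C < real m" using reals_Archimedean2 by blast
      have "\<phi> n x = 0" if "n \<ge> m" for n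
      proof -
        have "1 / infdist x C \<le> real n" using m that by linarith
        then show ?thesis using pos by (simp add: \<phi>_def field_simps)
      qed
      then have "eventually (\<lambda>n. \<phi> n x = 0) sequentially"
        using eventually_sequentially by blast
      then show ?thesis using False by (simp add: tendsto_eventually)
    qed
    have meas: "\<phi> n \<in> borel_measurable borel" for n
      using cont by (rule borel_measurable_continuous_onI)
    have Cs[measurable]: "C \<in> sets borel" using C by simp
    have conv: "(\<lambda>n. \<integral>x. \<phi> n x \<partial>L) \<longlonglongrightarrow> measure L C"
      if L: "prob_space L" "sets L = sets borel" for L
    proof -
      interpret L: prob_space L by (rule L)
      note L(2)[measurable_cong] meas[measurable]
      have "(\<lambda>n. \<integral>x. \<phi> n x \<partial>L) \<longlonglongrightarrow> (\<integral>x. indicator C x \<partial>L)"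
        by (rule integral_dominated_convergence[where w = "\<lambda>_. 1"]) (auto simp: lim bd)
      moreover have "(\<integral>x. indicator C x \<partial>L) = measure L C"
        using L(2) sets_eq_imp_space_eq[OF L(2)] by simp
      ultimately show ?thesis by simp
    qed
    have "(\<integral>x. \<phi> n x \<partial>M) = (\<integral>x. \<phi> n x \<partial>N)" for n
      using bd by (intro eq cont) (auto simp: bounded_iff)
    then show ?thesis
      using LIMSEQ_unique[OF conv[OF assms(1) M]] conv[OF assms(2) N] by simp
  qed
  have "emeasure M C = emeasure N C" if "closed C" for C
    using closed[OF that] by (cases "C = {}") (auto simp: M.emeasure_eq_measure N.emeasure_eq_measure)
  moreover have "sets (borel :: 'a measure) = sigma_sets UNIV {C. closed C}"
    unfolding borel_eq_closed by (rule sets_measure_of) auto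
  ultimately show ?thesis
    using M N
    by (intro measure_eqI_generator_eq[where E = "{C. closed C}" and \<Omega> = UNIV and A = "\<lambda>_. UNIV"])
       (auto simp only: Int_stable_def mem_Collect_eq closed_Int closed_UNIV Pow_UNIV subset_UNIV
         image_subset_iff UN_constant UNIV_not_empty if_False M.emeasure_finite N.emeasure_finite infinity_ennreal_def)
qed

lemma is_gain_unique:
  assumes "is_gain e \<mu> f g Q" "is_gain e \<mu> f g Q'"
  shows "Q = Q'"
  using assms unfolding is_gain_def by (intro prob_measure_eqI_continuous) auto

lemma is_gain_distr:
  assumes \<mu>: "prob_space \<mu>" "sets \<mu> = sets borel"
    and f: "prob_space f" "sets f = sets borel" and g: "prob_space g" "sets g = sets borel"
  shows "is_gain e \<mu> f g (density
    (distr (\<mu> \<Otimes>\<^sub>M (f \<Otimes>\<^sub>M (g \<Otimes>\<^sub>M sphere_measure))) borel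
       (\<lambda>(\<eta>, v, w, \<sigma>). post_velocity (e + \<eta>) v w \<sigma>)) (\<lambda>_. ennreal (1 / (4 * pi))))"
    (is "is_gain e \<mu> f g (density (distr ?M borel ?F) ?c)")
proof -
  interpret \<mu>: prob_space \<mu> by fact
  interpret f: prob_space f by fact
  interpret g: prob_space g by fact
  interpret S: finite_measure sphere_measure by (rule finite_measure_sphere_measure)
  interpret p1: pair_sigma_finite g sphere_measure ..
  interpret P1: finite_measure "g \<Otimes>\<^sub>M sphere_measure"
    by (intro finite_measure_pair_measure g.finite_measure_axioms S.finite_measure_axioms)
  interpret p2: pair_sigma_finite f "g \<Otimes>\<^sub>M sphere_measure" ..
  interpret P2: finite_measure "f \<Otimes>\<^sub>M (g \<Otimes>\<^sub>M sphere_measure)"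
    by (intro finite_measure_pair_measure f.finite_measure_axioms P1.finite_measure_axioms)
  interpret p3: pair_sigma_finite \<mu> "f \<Otimes>\<^sub>M (g \<Otimes>\<^sub>M sphere_measure)" ..
  interpret P3: finite_measure ?M
    by (intro finite_measure_pair_measure \<mu>.finite_measure_axioms P2.finite_measure_axioms)
  note \<mu>(2)[measurable_cong] f(2)[measurable_cong] g(2)[measurable_cong]
  have F[measurable]: "?F \<in> borel_measurable (borel \<Otimes>\<^sub>M (borel \<Otimes>\<^sub>M (borel \<Otimes>\<^sub>M borel)))"
    using post_velocity_measurable by (simp add: borel_prod)
  have F_M[measurable]: "?F \<in> borel_measurable ?M" by measurable
  have sp: "space \<mu> = UNIV" "space f = UNIV" "space g = UNIV"
    using sets_eq_imp_space_eq[OF \<mu>(2)] sets_eq_imp_space_eq[OF f(2)] sets_eq_imp_space_eq[OF g(2)]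
    by auto
  have sets1: "UNIV \<in> sets (g \<Otimes>\<^sub>M sphere_measure)"
    using sets.top[of "g \<Otimes>\<^sub>M sphere_measure"] by (simp add: space_pair_measure sp)
  have sets2: "UNIV \<in> sets (f \<Otimes>\<^sub>M (g \<Otimes>\<^sub>M sphere_measure))"
    using sets.top[of "f \<Otimes>\<^sub>M (g \<Otimes>\<^sub>M sphere_measure)"] by (simp add: space_pair_measure sp)
  have e1: "emeasure (g \<Otimes>\<^sub>M sphere_measure) (UNIV \<times> UNIV) = ennreal (4 * pi)"
    using g.emeasure_space_1
    by (subst S.emeasure_pair_measure_Times) (auto simp: g emeasure_sphere_measure sp)
  have e2: "emeasure (f \<Otimes>\<^sub>M (g \<Otimes>\<^sub>M sphere_measure)) (UNIV \<times> UNIV) = ennreal (4 * pi)"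
    using f.emeasure_space_1 e1 sets1 sets.top[of f]
    by (subst sigma_finite_measure.emeasure_pair_measure_Times[OF P1.sigma_finite_measure]) (simp_all add: sp)
  have e3: "emeasure ?M UNIV = ennreal (4 * pi)"
  proof -
    have "emeasure ?M (UNIV \<times> UNIV) = ennreal (4 * pi)"
      using \<mu>.emeasure_space_1 e2 sets2 sets.top[of \<mu>]
      by (subst sigma_finite_measure.emeasure_pair_measure_Times[OF P2.sigma_finite_measure]) (simp_all add: sp)
    then show ?thesis by simp
  qed
  have prob: "prob_space (density (distr ?M borel ?F) ?c)"
  proof (rule prob_spaceI)
    have "emeasure (distr ?M borel ?F) UNIV = ennreal (4 * pi)"
      using e3 by (subst emeasure_distr) (auto simp: sp space_pair_measure)
    then show "emeasure (density (distr ?M borel ?F) ?c) (space (density (distr ?M borel ?F) ?c)) = 1"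
      by (simp add: emeasure_density nn_integral_cmult_indicator ennreal_mult[symmetric])
  qed
  have int: "(\<integral>u. \<phi> u \<partial>density (distr ?M borel ?F) ?c) =
        1 / (4 * pi) * (\<integral>\<eta>. (\<integral>v. (\<integral>w. (\<integral>\<sigma>. \<phi> (post_velocity (e + \<eta>) v w \<sigma>)
          \<partial>sphere_measure) \<partial>g) \<partial>f) \<partial>\<mu>)"
    if \<phi>: "continuous_on UNIV \<phi>" "bounded (range \<phi>)" for \<phi> :: "real^3 \<Rightarrow> real"
  proof -
    obtain B where B: "\<And>x. \<bar>\<phi> x\<bar> \<le> B"
      using \<phi>(2) by (auto simp: bounded_iff)
    have [measurable]: "\<phi> \<in> borel_measurable borel"
      using \<phi>(1) by (rule borel_measurable_continuous_onI)
    have i3: "integrable ?M (\<lambda>x. \<phi> (?F x))"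
      by (rule P3.integrable_const_bound[where B = B]) (auto simp: B)
    have i2: "integrable (f \<Otimes>\<^sub>M (g \<Otimes>\<^sub>M sphere_measure)) (\<lambda>x. \<phi> (?F (\<eta>, x)))" for \<eta>
      by (rule P2.integrable_const_bound[where B = B]) (auto simp: B)
    have i1: "integrable (g \<Otimes>\<^sub>M sphere_measure) (\<lambda>x. \<phi> (?F (\<eta>, v, x)))" for \<eta> v
      by (rule P1.integrable_const_bound[where B = B]) (auto simp: B)
    have "(\<integral>u. \<phi> u \<partial>density (distr ?M borel ?F) ?c) = 1 / (4 * pi) * (\<integral>x. \<phi> (?F x) \<partial>?M)"
      by (subst integral_density) (auto simp: integral_distr)
    also have "(\<integral>x. \<phi> (?F x) \<partial>?M) = (\<integral>\<eta>. (\<integral>x. \<phi> (?F (\<eta>, x)) \<partial>(f \<Otimes>\<^sub>M (g \<Otimes>\<^sub>M sphere_measure))) \<partial>\<mu>)"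
      by (rule p3.integral_fst'[OF i3, symmetric])
    also have "\<dots> = (\<integral>\<eta>. (\<integral>v. (\<integral>x. \<phi> (?F (\<eta>, v, x)) \<partial>(g \<Otimes>\<^sub>M sphere_measure)) \<partial>f) \<partial>\<mu>)"
      by (subst p2.integral_fst'[OF i2, symmetric]) (rule refl)
    also have "\<dots> = (\<integral>\<eta>. (\<integral>v. (\<integral>w. (\<integral>\<sigma>. \<phi> (?F (\<eta>, v, w, \<sigma>)) \<partial>sphere_measure) \<partial>g) \<partial>f) \<partial>\<mu>)"
      by (subst p1.integral_fst'[OF i1, symmetric]) (rule refl)
    finally show ?thesis by simp
  qed
  show ?thesis
    unfolding is_gain_def using prob int by auto
qed

lemma is_gain_gain:
  assumes "prob_space \<mu>" "sets \<mu> = sets borel"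
    and "prob_space f" "sets f = sets borel" "prob_space g" "sets g = sets borel"
  shows "is_gain e \<mu> f g (gain e \<mu> f g)"
  unfolding gain_def
  using is_gain_distr[OF assms, of e] by (rule theI) (rule is_gain_unique[OF _ is_gain_distr[OF assms]])

end

theory Submission
  imports Defs
begin

text \<open>
  The gain operator is the law of the velocity \<open>v'\<close> produced by independent particles \<open>v, w\<close>
  with law \<open>f\<close>, an independent restitution coefficient \<open>r = e + \<eta>\<close> and an independent uniform
  direction \<open>\<sigma>\<close>. So a coupling \<open>\<gamma>\<close> of \<open>f\<close> and \<open>g\<close> induces one of the two gain measures: draw
  \<open>(v, x)\<close> and \<open>(w, y)\<close> independently from \<open>\<gamma>\<close>, and let the pairs \<open>(v, w)\<close> and \<open>(x, y)\<close> collide with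
  the same \<open>\<eta>\<close> and the same \<open>\<sigma>\<close> (\<open>collision_coupling_in_couplings\<close>). It is enough that this
  coupling costs at most as much as \<open>\<gamma>\<close> (\<open>collision_coupling_cost_le\<close>); the infimum over
  \<open>\<gamma>\<close> then gives the contraction, and no optimal coupling has to exist.

  Put \<open>V = v - x\<close> and \<open>W = w - y\<close>. For given \<open>v, w, x, y, \<eta>\<close> the two post-collisional velocities lie
  on two spheres and correspond under the translation and dilation that maps one sphere to the other.
  Their difference is \<open>a + b \<sigma>\<close> with
  \<open>a = (V + W) / 2 + (1 - r) (V - W) / 4\<close> and \<open>b = (1 + r) (|v - w| - |x - y|) / 4\<close>.
  As \<open>\<sigma>\<close> has mean \<open>0\<close>, the average of \<open>|a + b \<sigma>|\<^sup>2\<close> is \<open>|a|\<^sup>2 + b\<^sup>2\<close>, and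
  \<open>b\<^sup>2 \<le> (1 + r)\<^sup>2 |V - W|\<^sup>2 / 16\<close> by the triangle inequality. The result is quadratic in \<open>r\<close>, and
  \<open>\<beta>\<^sup>2 = 1 - e\<^sup>2\<close> says that \<open>r\<^sup>2\<close> has mean \<open>1\<close>. Hence the coefficient of \<open>|V - W|\<^sup>2\<close> averages to
  \<open>1 / 4\<close>, the same as that of \<open>|V + W|\<^sup>2\<close>, and the parallelogram law turns the average over \<open>\<eta>\<close> into
  \<open>(3 - e) / 4 |V|\<^sup>2 + (1 + e) / 4 |W|\<^sup>2\<close>. Since \<open>V\<close> and \<open>W\<close> have the same law and
  the two weights add up to \<open>1\<close>, the total cost is at most the mean of \<open>|V|\<^sup>2\<close>.
\<close>

section \<open>Averages over the sphere\<close>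

lemma norm_sphere_point: "norm (sphere_point p) = 1"
proof -
  obtain \<theta> \<phi> where p: "p = (\<theta>, \<phi>)" by (cases p)
  have "(sin \<theta> * cos \<phi>)\<^sup>2 + (sin \<theta> * sin \<phi>)\<^sup>2 + (cos \<theta>)\<^sup>2
      = (sin \<theta>)\<^sup>2 * ((sin \<phi>)\<^sup>2 + (cos \<phi>)\<^sup>2) + (cos \<theta>)\<^sup>2"
    by (simp only: power_mult_distrib distrib_left)
  also have "\<dots> = 1"
    by simp
  finally show ?thesis
    by (simp add: p sphere_point_def norm_eq_1 inner_vec_def sum_3 vector_3 power2_eq_square)
qed

lemma AE_sphere_measure_norm: "AE \<sigma> in sphere_measure. norm \<sigma> = 1"
  unfolding sphere_measure_def
  by (subst AE_distr_iff) (auto simp: norm_sphere_point)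

text \<open>In spherical coordinates, the two horizontal components of \<open>\<sigma>\<close> vanish when integrated over the
  azimuth \<open>\<phi>\<close>. The vertical one leaves \<open>sin \<theta> cos \<theta>\<close>, the derivative of \<open>sin\<^sup>2 \<theta> / 2\<close>, which is \<open>0\<close> at
  both poles.\<close>

lemma integral_sphere_measure_inner: "(\<integral>\<sigma>. c \<bullet> \<sigma> \<partial>sphere_measure) = 0"
proof -
  define s :: "real \<times> real \<Rightarrow> real" where "s = (\<lambda>p. sin (fst p) * indicator ({0..pi} \<times> {0..2 * pi}) p)"
  have s [measurable]: "s \<in> borel_measurable borel"
    unfolding s_def borel_prod[symmetric] by measurable
  have s_nonneg: "0 \<le> s p" for p
    by (auto simp: s_def sin_ge_zero split: split_indicator)
  define h where "h = (\<lambda>p. s p * (c \<bullet> sphere_point p))"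
  have h [measurable]: "h \<in> borel_measurable borel"
    unfolding h_def by measurable
  have "sphere_measure = distr (density lborel (\<lambda>p. ennreal (s p))) borel sphere_point"
    unfolding sphere_measure_def s_def
    by (intro arg_cong3[where f = distr] arg_cong2[where f = density])
       (auto simp: fun_eq_iff split: split_indicator)
  then have "(\<integral>\<sigma>. c \<bullet> \<sigma> \<partial>sphere_measure)
      = (\<integral>p. c \<bullet> sphere_point p \<partial>density lborel (\<lambda>p. ennreal (s p)))"
    using integral_distr[of sphere_point "density lborel (\<lambda>p. ennreal (s p))" borel "\<lambda>\<sigma>. c \<bullet> \<sigma>"]
    by simp
  also have "\<dots> = (\<integral>p. h p \<partial>lborel)"
    by (subst integral_density) (simp_all add: h_def s_nonneg)
  also have "\<dots> = (\<integral>p. h p \<partial>(lborel \<Otimes>\<^sub>M lborel))"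
    by (simp add: lborel_prod)
  also have "\<dots> = (\<integral>\<theta>. (\<integral>\<phi>. h (\<theta>, \<phi>) \<partial>lborel) \<partial>lborel)"
  proof (rule lborel_pair.integral_fst'[symmetric])
    have "integrable lborel (\<lambda>p::real \<times> real. indicator (cbox (0, 0) (pi, 2 * pi)) p * norm c)"
      by (intro integrable_mult_left integrable_real_indicator)
         (use emeasure_lborel_cbox_finite[of "(0, 0)" "(pi, 2 * pi)"] in simp_all)
    then have "integrable lborel h"
    proof (rule Bochner_Integration.integrable_bound)
      have "norm (h p) \<le> norm (indicator (cbox (0, 0) (pi, 2 * pi)) p * norm c)" for p
      proof -
        obtain \<theta> \<phi> where p: "p = (\<theta>, \<phi>)" by (cases p)
        have "\<bar>c \<bullet> sphere_point p\<bar> \<le> norm c"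
          using Cauchy_Schwarz_ineq2[of c "sphere_point p"] by (simp add: norm_sphere_point)
        then have "\<bar>sin \<theta>\<bar> * \<bar>c \<bullet> sphere_point p\<bar> \<le> 1 * norm c"
          by (intro mult_mono) auto
        then show ?thesis
          by (auto simp: h_def s_def p abs_mult cbox_Pair_eq split: split_indicator)
      qed
      then show "AE p in lborel. norm (h p) \<le> norm (indicator (cbox (0, 0) (pi, 2 * pi)) p * norm c)"
        by simp
    qed simp
    then show "integrable (lborel \<Otimes>\<^sub>M lborel) h"
      by (simp add: lborel_prod)
  qed
  also have "\<dots> = (\<integral>\<theta>. (2 * pi * c $ 3 * (sin \<theta> * cos \<theta>)) * indicator {0..pi} \<theta> \<partial>lborel)"
  proof (rule Bochner_Integration.integral_cong[OF refl])
    fix \<theta> :: real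
    let ?F = "\<lambda>\<phi>. sin \<theta> * (c $ 1 * sin \<theta> * sin \<phi> - c $ 2 * sin \<theta> * cos \<phi> + c $ 3 * cos \<theta> * \<phi>)"
    let ?f = "\<lambda>\<phi>. sin \<theta> * (c $ 1 * sin \<theta> * cos \<phi> + c $ 2 * sin \<theta> * sin \<phi> + c $ 3 * cos \<theta>)"
    have "(\<integral>\<phi>. h (\<theta>, \<phi>) \<partial>lborel)
        = (\<integral>\<phi>. indicator {0..pi} \<theta> * (?f \<phi> * indicator {0..2 * pi} \<phi>) \<partial>lborel)"
      by (intro Bochner_Integration.integral_cong refl)
         (auto simp: h_def s_def sphere_point_def inner_vec_def sum_3 vector_3 algebra_simps split: split_indicator)
    also have "\<dots> = indicator {0..pi} \<theta> * (\<integral>\<phi>. ?f \<phi> * indicator {0..2 * pi} \<phi> \<partial>lborel)"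
      by simp
    also have "(\<integral>\<phi>. ?f \<phi> * indicator {0..2 * pi} \<phi> \<partial>lborel) = ?F (2 * pi) - ?F 0"
      by (rule integral_FTC_Icc_real)
         (auto intro!: derivative_eq_intros continuous_intros simp: algebra_simps)
    finally show "(\<integral>\<phi>. h (\<theta>, \<phi>) \<partial>lborel) = (2 * pi * c $ 3 * (sin \<theta> * cos \<theta>)) * indicator {0..pi} \<theta>"
      by (simp add: algebra_simps)
  qed
  also have "\<dots> = pi * c $ 3 * (sin pi)\<^sup>2 - pi * c $ 3 * (sin 0)\<^sup>2"
    by (rule integral_FTC_Icc_real)
       (auto intro!: derivative_eq_intros continuous_intros)
  finally show ?thesis
    by simp
qed

text \<open>The mixed term of the square is linear in \<open>\<sigma>\<close> and averages out, which leaves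
  Pythagoras for \<open>a\<close> and \<open>b \<sigma>\<close>.\<close>

lemma nn_integral_sphere_measure_affine:
  "(\<integral>\<^sup>+\<sigma>. ennreal ((norm (a + b *\<^sub>R \<sigma>))\<^sup>2) \<partial>sphere_measure)
    = ennreal (4 * pi * ((norm a)\<^sup>2 + b\<^sup>2))"
proof -
  interpret S: finite_measure sphere_measure
    by (rule finite_measure_sphere_measure)
  have expand: "(norm (a + b *\<^sub>R \<sigma>))\<^sup>2 = ((norm a)\<^sup>2 + b\<^sup>2) + (2 * b) * (a \<bullet> \<sigma>)"
    if "norm \<sigma> = 1" for \<sigma> :: "real^3"
    using that unfolding power2_norm_eq_inner norm_eq_1
    by (simp add: inner_simps inner_commute power2_eq_square algebra_simps)
  have int: "integrable sphere_measure (\<lambda>\<sigma>. a \<bullet> \<sigma>)"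
  proof (rule S.integrable_const_bound[where B = "norm a"])
    show "AE \<sigma> in sphere_measure. norm (a \<bullet> \<sigma>) \<le> norm a"
      using AE_sphere_measure_norm
    proof eventually_elim
      case (elim \<sigma>)
      then show ?case
        using Cauchy_Schwarz_ineq2[of a \<sigma>] by simp
    qed
  qed simp
  have "(\<integral>\<^sup>+\<sigma>. ennreal ((norm (a + b *\<^sub>R \<sigma>))\<^sup>2) \<partial>sphere_measure)
      = (\<integral>\<^sup>+\<sigma>. ennreal (((norm a)\<^sup>2 + b\<^sup>2) + (2 * b) * (a \<bullet> \<sigma>)) \<partial>sphere_measure)"
    using AE_sphere_measure_norm by (intro nn_integral_cong_AE) (auto simp: expand elim!: eventually_mono)
  also have "\<dots> = ennreal (\<integral>\<sigma>. ((norm a)\<^sup>2 + b\<^sup>2) + (2 * b) * (a \<bullet> \<sigma>) \<partial>sphere_measure)"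
  proof (rule nn_integral_eq_integral)
    show "AE \<sigma> in sphere_measure. 0 \<le> ((norm a)\<^sup>2 + b\<^sup>2) + (2 * b) * (a \<bullet> \<sigma>)"
      using AE_sphere_measure_norm by eventually_elim (metis expand zero_le_power2)
  qed (use int in auto)
  also have "(\<integral>\<sigma>. ((norm a)\<^sup>2 + b\<^sup>2) + (2 * b) * (a \<bullet> \<sigma>) \<partial>sphere_measure)
      = 4 * pi * ((norm a)\<^sup>2 + b\<^sup>2)"
    using int by (subst Bochner_Integration.integral_add)
      (auto simp: integral_sphere_measure_inner measure_def emeasure_sphere_measure)
  finally show ?thesis .
qed

section \<open>The cost of a pair of collisions\<close>

text \<open>Using the same direction in both collisions couples the uniform measures on the two spheres of
  possible outcomes so that only the difference \<open>a\<close> of the centres and the difference \<open>b\<close> of the radii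
  are paid for. The radii are proportional to the relative speeds, so the triangle inequality
  bounds \<open>b\<close> by the difference of the relative velocities.\<close>

lemma nn_integral_sphere_post_velocity_le:
  "(\<integral>\<^sup>+\<sigma>. ennreal ((norm (post_velocity r v w \<sigma> - post_velocity r x y \<sigma>))\<^sup>2) \<partial>sphere_measure)
    \<le> ennreal (4 * pi * ((norm ((v - x) + (w - y)))\<^sup>2 / 4
        + (1 - r) / 4 * ((norm (v - x))\<^sup>2 - (norm (w - y))\<^sup>2)
        + (1 + r\<^sup>2) / 8 * (norm ((v - x) - (w - y)))\<^sup>2))"
proof -
  define V W where "V = v - x" and "W = w - y"
  define a where "a = (1 / 2) *\<^sub>R (V + W) + ((1 - r) / 4) *\<^sub>R (V - W)"
  define b where "b = (1 + r) / 4 * (norm (v - w) - norm (x - y))"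
  have diff: "post_velocity r v w \<sigma> - post_velocity r x y \<sigma> = a + b *\<^sub>R \<sigma>" for \<sigma>
    unfolding post_velocity_def a_def b_def V_def W_def
    by (simp add: algebra_simps flip: scaleR_add_left)
  have "\<bar>norm (v - w) - norm (x - y)\<bar> \<le> norm ((v - w) - (x - y))"
    by (rule norm_triangle_ineq3)
  also have "(v - w) - (x - y) = V - W"
    by (simp add: V_def W_def)
  finally have "(norm (v - w) - norm (x - y))\<^sup>2 \<le> (norm (V - W))\<^sup>2"
    by (metis abs_ge_zero power2_abs power_mono)
  then have "b\<^sup>2 \<le> ((1 + r) / 4)\<^sup>2 * (norm (V - W))\<^sup>2"
    unfolding b_def power_mult_distrib by (rule mult_left_mono) simp
  moreover have "(norm a)\<^sup>2 = (norm (V + W))\<^sup>2 / 4 + (1 - r) / 4 * ((norm V)\<^sup>2 - (norm W)\<^sup>2)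
      + ((1 - r) / 4)\<^sup>2 * (norm (V - W))\<^sup>2"
    unfolding a_def power2_norm_eq_inner
    by (simp add: inner_simps inner_commute field_simps power2_eq_square)
  ultimately have "(norm a)\<^sup>2 + b\<^sup>2 \<le> (norm (V + W))\<^sup>2 / 4 + (1 - r) / 4 * ((norm V)\<^sup>2 - (norm W)\<^sup>2)
      + (((1 - r) / 4)\<^sup>2 + ((1 + r) / 4)\<^sup>2) * (norm (V - W))\<^sup>2"
    by (simp add: distrib_right)
  also have "((1 - r) / 4)\<^sup>2 + ((1 + r) / 4)\<^sup>2 = (1 + r\<^sup>2) / 8"
    by (simp add: power2_eq_square field_simps)
  finally show ?thesis
    unfolding diff nn_integral_sphere_measure_affine V_def[symmetric] W_def[symmetric]
    by (intro ennreal_leI mult_left_mono) auto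
qed

text \<open>The right-hand side of the previous bound, averaged over the restitution coefficient. This is the
  step where being conservative in the mean enters: \<open>(e + \<eta>)\<^sup>2\<close> has mean \<open>1\<close>, so
  \<open>|V + W|\<^sup>2\<close> and \<open>|V - W|\<^sup>2\<close> get the same weight \<open>1 / 4\<close> and combine by the
  parallelogram law.\<close>

lemma nn_integral_fluctuation_law:
  fixes V W :: "real^3"
  assumes law: "fluctuation_law e \<beta> \<mu>" and \<beta>: "\<beta>\<^sup>2 = 1 - e\<^sup>2"
  shows "(\<integral>\<^sup>+\<eta>. ennreal ((norm (V + W))\<^sup>2 / 4 + (1 - (e + \<eta>)) / 4 * ((norm V)\<^sup>2 - (norm W)\<^sup>2)
        + (1 + (e + \<eta>)\<^sup>2) / 8 * (norm (V - W))\<^sup>2) \<partial>\<mu>)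
    = ennreal ((3 - e) / 4 * (norm V)\<^sup>2 + (1 + e) / 4 * (norm W)\<^sup>2)"
    (is "(\<integral>\<^sup>+\<eta>. ennreal (?P \<eta>) \<partial>\<mu>) = ennreal ?R")
proof -
  interpret \<mu>: prob_space \<mu>
    using law by (simp add: fluctuation_law_def)
  define A B where "A = (norm V)\<^sup>2 - (norm W)\<^sup>2" and "B = (norm (V - W))\<^sup>2"
  define C0 where "C0 = (norm (V + W))\<^sup>2 / 4 + (1 - e) / 4 * A + (1 + e\<^sup>2) / 8 * B"
  define C1 where "C1 = e / 4 * B - A / 4"
  have P: "?P \<eta> = C0 + C1 * \<eta> + B / 8 * \<eta>\<^sup>2" for \<eta>
    unfolding A_def[symmetric] B_def[symmetric] C0_def C1_def
    by (simp add: power2_eq_square field_simps)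
  have int: "integrable \<mu> (\<lambda>\<eta>. \<eta>)" "integrable \<mu> (\<lambda>\<eta>. \<eta>\<^sup>2)"
    and mean: "(\<integral>\<eta>. \<eta> \<partial>\<mu>) = 0" and var: "(\<integral>\<eta>. \<eta>\<^sup>2 \<partial>\<mu>) = 1 - e\<^sup>2"
    using law \<beta> by (auto simp: fluctuation_law_def)
  have par: "(norm (V + W))\<^sup>2 + (norm (V - W))\<^sup>2 = 2 * (norm V)\<^sup>2 + 2 * (norm W)\<^sup>2"
    unfolding power2_norm_eq_inner by (simp add: inner_simps inner_commute)
  have nonneg: "0 \<le> ?P \<eta>" for \<eta>
  proof -
    \<comment> \<open>The value of \<open>|a|\<^sup>2 + b\<^sup>2\<close> when the triangle inequality is an equality.\<close>
    have "?P \<eta> = (norm ((1 / 2) *\<^sub>R (V + W) + ((1 - (e + \<eta>)) / 4) *\<^sub>R (V - W)))\<^sup>2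
        + ((1 + (e + \<eta>)) / 4)\<^sup>2 * (norm (V - W))\<^sup>2"
      unfolding power2_norm_eq_inner
      by (simp add: inner_simps inner_commute field_simps power2_eq_square)
    then show ?thesis
      by simp
  qed
  have "(\<integral>\<^sup>+\<eta>. ennreal (?P \<eta>) \<partial>\<mu>) = ennreal (\<integral>\<eta>. ?P \<eta> \<partial>\<mu>)"
    using int nonneg unfolding P by (intro nn_integral_eq_integral) auto
  also have "(\<integral>\<eta>. ?P \<eta> \<partial>\<mu>) = C0 + B / 8 * (1 - e\<^sup>2)"
    using int unfolding P by (simp add: mean var \<mu>.prob_space)
  also have "\<dots> = ((norm (V + W))\<^sup>2 + B) / 4 + (1 - e) / 4 * A"
    by (simp add: C0_def field_simps)
  also have "\<dots> = ?R"
    unfolding B_def par by (simp add: A_def field_simps)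
  finally show ?thesis .
qed

section \<open>The gain operator as the law of a post-collisional velocity\<close>

text \<open>The gain measure is defined through test functions. Here it is written as the law of an explicit
  random variable on a product space in which the incoming particles are functions \<open>h p\<close> and \<open>h q\<close> of
  auxiliary independent \<open>p, q\<close>. With \<open>h\<close> the first or the second projection of a coupling,
  both gain measures live on one and the same space.\<close>

lemma gain_eq_distr_post_velocity:
  assumes \<mu>: "prob_space \<mu>" "sets \<mu> = sets borel"
    and \<gamma>: "prob_space \<gamma>" and h [measurable]: "h \<in> borel_measurable \<gamma>"
  shows "gain e \<mu> (distr \<gamma> borel h) (distr \<gamma> borel h) =
    distr (density (\<mu> \<Otimes>\<^sub>M (\<gamma> \<Otimes>\<^sub>M (\<gamma> \<Otimes>\<^sub>M sphere_measure))) (\<lambda>_. ennreal (1 / (4 * pi)))) borel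
      (\<lambda>(\<eta>, p, q, \<sigma>). post_velocity (e + \<eta>) (h p) (h q) \<sigma>)"
proof -
  interpret \<mu>: prob_space \<mu> by fact
  interpret \<gamma>: prob_space \<gamma> by fact
  interpret S: finite_measure sphere_measure by (rule finite_measure_sphere_measure)
  note \<mu>(2)[measurable_cong]
  let ?f = "distr \<gamma> borel h"
  let ?F = "\<lambda>(\<eta>, v, w, \<sigma>). post_velocity (e + \<eta>) v w \<sigma>"
  have F: "?F \<in> borel_measurable (borel \<Otimes>\<^sub>M (borel \<Otimes>\<^sub>M (borel \<Otimes>\<^sub>M borel)))"
    using post_velocity_measurable by (simp add: borel_prod)
  have f: "prob_space ?f" "sets ?f = sets borel"
    by (simp_all add: \<gamma>.prob_space_distr)
  interpret f: prob_space ?f by (rule f)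
  have S_id: "distr sphere_measure borel (\<lambda>x. x) = sphere_measure"
    by (rule distr_id2) simp
  have \<mu>_id: "distr \<mu> borel (\<lambda>x. x) = \<mu>"
    by (rule distr_id2) (simp add: \<mu>)
  have sf1: "sigma_finite_measure (?f \<Otimes>\<^sub>M sphere_measure)"
    and sf2: "sigma_finite_measure (?f \<Otimes>\<^sub>M (?f \<Otimes>\<^sub>M sphere_measure))"
    by (intro finite_measure.sigma_finite_measure finite_measure_pair_measure
        f.finite_measure_axioms S.finite_measure_axioms)+
  have prod1: "?f \<Otimes>\<^sub>M sphere_measure
      = distr (\<gamma> \<Otimes>\<^sub>M sphere_measure) (borel \<Otimes>\<^sub>M borel) (\<lambda>(q, \<sigma>). (h q, \<sigma>))"
  proof -
    have "sigma_finite_measure (distr sphere_measure borel (\<lambda>x. x))"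
      unfolding S_id by (rule S.sigma_finite_measure)
    from pair_measure_distr[OF h _ this] show ?thesis
      unfolding S_id by measurable
  qed
  have prod2: "?f \<Otimes>\<^sub>M (?f \<Otimes>\<^sub>M sphere_measure)
      = distr (\<gamma> \<Otimes>\<^sub>M (\<gamma> \<Otimes>\<^sub>M sphere_measure)) (borel \<Otimes>\<^sub>M (borel \<Otimes>\<^sub>M borel))
          (\<lambda>(p, q, \<sigma>). (h p, h q, \<sigma>))"
    using sf1 unfolding prod1
    by (subst pair_measure_distr[OF h]) (simp_all add: case_prod_beta')
  have prod3: "\<mu> \<Otimes>\<^sub>M (?f \<Otimes>\<^sub>M (?f \<Otimes>\<^sub>M sphere_measure))
      = distr (\<mu> \<Otimes>\<^sub>M (\<gamma> \<Otimes>\<^sub>M (\<gamma> \<Otimes>\<^sub>M sphere_measure))) (borel \<Otimes>\<^sub>M (borel \<Otimes>\<^sub>M (borel \<Otimes>\<^sub>M borel)))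
          (\<lambda>(\<eta>, p, q, \<sigma>). (\<eta>, h p, h q, \<sigma>))"
  proof -
    have "(\<lambda>x. x) \<in> measurable \<mu> borel"
      by measurable
    from pair_measure_distr[OF this _ sf2[unfolded prod2]] show ?thesis
      unfolding prod2 \<mu>_id by (simp add: case_prod_beta')
  qed
  have "gain e \<mu> ?f ?f = density (distr (\<mu> \<Otimes>\<^sub>M (?f \<Otimes>\<^sub>M (?f \<Otimes>\<^sub>M sphere_measure))) borel ?F)
      (\<lambda>_. ennreal (1 / (4 * pi)))"
    by (rule is_gain_unique[OF is_gain_gain[OF \<mu> f f] is_gain_distr[OF \<mu> f f]])
  also have "distr (\<mu> \<Otimes>\<^sub>M (?f \<Otimes>\<^sub>M (?f \<Otimes>\<^sub>M sphere_measure))) borel ?F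
      = distr (\<mu> \<Otimes>\<^sub>M (\<gamma> \<Otimes>\<^sub>M (\<gamma> \<Otimes>\<^sub>M sphere_measure))) borel
          (\<lambda>(\<eta>, p, q, \<sigma>). post_velocity (e + \<eta>) (h p) (h q) \<sigma>)"
    unfolding prod3 by (subst distr_distr[OF F]) (simp_all add: comp_def case_prod_beta')
  also have "density \<dots> (\<lambda>_. ennreal (1 / (4 * pi))) =
      distr (density (\<mu> \<Otimes>\<^sub>M (\<gamma> \<Otimes>\<^sub>M (\<gamma> \<Otimes>\<^sub>M sphere_measure))) (\<lambda>_. ennreal (1 / (4 * pi)))) borel
        (\<lambda>(\<eta>, p, q, \<sigma>). post_velocity (e + \<eta>) (h p) (h q) \<sigma>)"
  proof (subst density_distr)
    have "(\<lambda>(\<eta>, p, q, \<sigma>). (\<eta>, h p, h q, \<sigma>)) \<in> measurable (\<mu> \<Otimes>\<^sub>M (\<gamma> \<Otimes>\<^sub>M (\<gamma> \<Otimes>\<^sub>M sphere_measure)))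
        (borel \<Otimes>\<^sub>M (borel \<Otimes>\<^sub>M (borel \<Otimes>\<^sub>M borel)))"
      by measurable
    from measurable_compose[OF this F]
    show "(\<lambda>(\<eta>, p, q, \<sigma>). post_velocity (e + \<eta>) (h p) (h q) \<sigma>)
        \<in> borel_measurable (\<mu> \<Otimes>\<^sub>M (\<gamma> \<Otimes>\<^sub>M (\<gamma> \<Otimes>\<^sub>M sphere_measure)))"
      by (simp add: case_prod_beta')
  qed simp_all
  finally show ?thesis .
qed

section \<open>The coupling of the gain measures\<close>

text \<open>The density \<open>1 / (4 \<pi>)\<close> normalises the surface measure, whose mass is \<open>4 \<pi>\<close>.\<close>

definition collision_coupling ::
  "real \<Rightarrow> real measure \<Rightarrow> ((real^3) \<times> (real^3)) measure \<Rightarrow> ((real^3) \<times> (real^3)) measure" where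
  "collision_coupling e \<mu> \<gamma> =
    distr (density (\<mu> \<Otimes>\<^sub>M (\<gamma> \<Otimes>\<^sub>M (\<gamma> \<Otimes>\<^sub>M sphere_measure))) (\<lambda>_. ennreal (1 / (4 * pi)))) borel
      (\<lambda>(\<eta>, p, q, \<sigma>). (post_velocity (e + \<eta>) (fst p) (fst q) \<sigma>,
                      post_velocity (e + \<eta>) (snd p) (snd q) \<sigma>))"

lemma post_velocity_pair_measurable:
  assumes "sets \<mu> = sets borel" and "sets \<gamma> = sets borel"
  shows "(\<lambda>(\<eta>, p, q, \<sigma>). (post_velocity (e + \<eta>) (fst p) (fst q) \<sigma>,
                      post_velocity (e + \<eta>) (snd p) (snd q) \<sigma>))
    \<in> borel_measurable (\<mu> \<Otimes>\<^sub>M (\<gamma> \<Otimes>\<^sub>M (\<gamma> \<Otimes>\<^sub>M sphere_measure)))"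
proof -
  have "(\<lambda>(\<eta>, p, q, \<sigma>). (post_velocity (e + \<eta>) (fst p) (fst q) \<sigma>,
                      post_velocity (e + \<eta>) (snd p) (snd q) \<sigma>)) \<in> borel_measurable borel"
    unfolding post_velocity_def case_prod_beta
    by (intro borel_measurable_continuous_onI continuous_intros) auto
  moreover have "sets (\<mu> \<Otimes>\<^sub>M (\<gamma> \<Otimes>\<^sub>M (\<gamma> \<Otimes>\<^sub>M sphere_measure))) = sets borel"
    unfolding borel_prod[symmetric] using assms
    by (intro sets_pair_measure_cong) (simp_all only: borel_prod sets_sphere_measure)
  ultimately show ?thesis
    by (subst measurable_cong_sets[OF _ refl])
qed

lemma collision_coupling_in_couplings:
  assumes \<mu>: "prob_space \<mu>" "sets \<mu> = sets borel" and \<gamma>: "\<gamma> \<in> couplings f g"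
  shows "collision_coupling e \<mu> \<gamma> \<in> couplings (gain e \<mu> f f) (gain e \<mu> g g)"
proof -
  have \<gamma>': "prob_space \<gamma>" "sets \<gamma> = sets borel"
    and f: "distr \<gamma> borel fst = f" and g: "distr \<gamma> borel snd = g"
    using \<gamma> by (auto simp: couplings_def)
  have \<gamma>_prod: "sets \<gamma> = sets (borel \<Otimes>\<^sub>M borel)"
    unfolding borel_prod by fact
  then have fst: "fst \<in> borel_measurable \<gamma>" and snd: "snd \<in> borel_measurable \<gamma>"
    by (auto cong: measurable_cong_sets)
  have fst': "fst \<in> borel_measurable (borel :: ((real^3) \<times> (real^3)) measure)"
    and snd': "snd \<in> borel_measurable (borel :: ((real^3) \<times> (real^3)) measure)"
    by (auto simp flip: borel_prod)
  note pv = post_velocity_pair_measurable[OF \<mu>(2) \<gamma>'(2), of e]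
  have 1: "distr (collision_coupling e \<mu> \<gamma>) borel fst = gain e \<mu> f f"
    using gain_eq_distr_post_velocity[OF \<mu> \<gamma>'(1) fst, of e] unfolding f collision_coupling_def
    by (subst distr_distr[OF fst']) (simp_all add: pv[unfolded case_prod_beta'] comp_def case_prod_beta')
  have 2: "distr (collision_coupling e \<mu> \<gamma>) borel snd = gain e \<mu> g g"
    using gain_eq_distr_post_velocity[OF \<mu> \<gamma>'(1) snd, of e] unfolding g collision_coupling_def
    by (subst distr_distr[OF snd']) (simp_all add: pv[unfolded case_prod_beta'] comp_def case_prod_beta')
  interpret \<gamma>: prob_space \<gamma> by fact
  have pf: "prob_space f" "sets f = sets borel"
    unfolding f[symmetric] using fst by (simp_all add: \<gamma>.prob_space_distr)
  \<comment> \<open>The total mass is that of a marginal.\<close>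
  have "prob_space (distr (collision_coupling e \<mu> \<gamma>) borel fst)"
    unfolding 1 using is_gain_gain[OF \<mu> pf pf] by (simp add: is_gain_def)
  then have "prob_space (collision_coupling e \<mu> \<gamma>)"
    by (rule prob_space_distrD[rotated]) (simp add: collision_coupling_def fst')
  with 1 2 show ?thesis
    by (simp add: couplings_def) (simp add: collision_coupling_def)
qed

text \<open>Integrate over \<open>\<sigma>\<close> first, since the bound after it is a polynomial in \<open>\<eta>\<close>, then over \<open>\<eta>\<close>,
  and finally over the two independent pairs. The constraint \<open>0 \<le> e \<le> 1\<close> makes the
  weights \<open>(3 - e) / 4\<close> and \<open>(1 + e) / 4\<close> nonnegative, so that the last integral splits in
  \<open>[0, \<infinity>]\<close> even if the cost of \<open>\<gamma>\<close> is infinite.\<close>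

lemma collision_coupling_cost_le:
  assumes "0 \<le> e" "e \<le> 1" and law: "fluctuation_law e \<beta> \<mu>" and \<beta>: "\<beta>\<^sup>2 = 1 - e\<^sup>2"
    and \<gamma>: "prob_space \<gamma>" "sets \<gamma> = sets borel"
  shows "(\<integral>\<^sup>+(v, x). ennreal ((norm (v - x))\<^sup>2) \<partial>collision_coupling e \<mu> \<gamma>)
    \<le> (\<integral>\<^sup>+(v, x). ennreal ((norm (v - x))\<^sup>2) \<partial>\<gamma>)"
proof -
  have \<mu>: "prob_space \<mu>" "sets \<mu> = sets borel"
    using law by (auto simp: fluctuation_law_def)
  interpret \<mu>: prob_space \<mu> by fact
  interpret \<gamma>: prob_space \<gamma> by fact
  interpret S: finite_measure sphere_measure by (rule finite_measure_sphere_measure)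
  interpret G1: finite_measure "\<gamma> \<Otimes>\<^sub>M sphere_measure"
    by (intro finite_measure_pair_measure \<gamma>.finite_measure_axioms S.finite_measure_axioms)
  interpret G2: finite_measure "\<gamma> \<Otimes>\<^sub>M (\<gamma> \<Otimes>\<^sub>M sphere_measure)"
    by (intro finite_measure_pair_measure \<gamma>.finite_measure_axioms G1.finite_measure_axioms)
  interpret GG: finite_measure "\<gamma> \<Otimes>\<^sub>M \<gamma>"
    by (intro finite_measure_pair_measure \<gamma>.finite_measure_axioms)
  interpret M: pair_sigma_finite \<mu> "\<gamma> \<Otimes>\<^sub>M \<gamma>" ..
  have \<gamma>_prod [measurable_cong]: "sets \<gamma> = sets (borel \<Otimes>\<^sub>M borel)"
    unfolding borel_prod by fact
  note \<mu>(2)[measurable_cong]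
  let ?M = "\<mu> \<Otimes>\<^sub>M (\<gamma> \<Otimes>\<^sub>M (\<gamma> \<Otimes>\<^sub>M sphere_measure))"
  let ?d = "\<lambda>p :: (real^3) \<times> (real^3). fst p - snd p"
  let ?K = "\<integral>\<^sup>+p. ennreal ((norm (?d p))\<^sup>2) \<partial>\<gamma>"
  define c where "c = (\<lambda>(\<eta>, p, q, \<sigma>). ennreal ((norm (post_velocity (e + \<eta>) (fst p) (fst q) \<sigma>
    - post_velocity (e + \<eta>) (snd p) (snd q) \<sigma>))\<^sup>2))"
  define P where "P = (\<lambda>\<eta> p q. (norm (?d p + ?d q))\<^sup>2 / 4
        + (1 - (e + \<eta>)) / 4 * ((norm (?d p))\<^sup>2 - (norm (?d q))\<^sup>2)
        + (1 + (e + \<eta>)\<^sup>2) / 8 * (norm (?d p - ?d q))\<^sup>2)"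
  have cost [measurable]: "(\<lambda>(v, x). ennreal ((norm (v - x))\<^sup>2)) \<in> borel_measurable (borel :: ((real^3) \<times> (real^3)) measure)"
    unfolding borel_prod[symmetric] by measurable
  note pv = post_velocity_pair_measurable[OF \<mu>(2) \<gamma>(2), of e]
  have c [measurable]: "c \<in> borel_measurable ?M"
    using measurable_compose[OF pv cost]
    by (simp add: c_def case_prod_beta)
  have P_meas [measurable]: "(\<lambda>(\<eta>, p, q). ennreal (P \<eta> p q)) \<in> borel_measurable (\<mu> \<Otimes>\<^sub>M (\<gamma> \<Otimes>\<^sub>M \<gamma>))"
    unfolding P_def by measurable
  have "(\<integral>\<^sup>+(v, x). ennreal ((norm (v - x))\<^sup>2) \<partial>collision_coupling e \<mu> \<gamma>)
      = (\<integral>\<^sup>+z. c z \<partial>density ?M (\<lambda>_. ennreal (1 / (4 * pi))))"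
    unfolding collision_coupling_def using pv cost
    by (subst nn_integral_distr) (simp_all add: c_def case_prod_beta')
  also have "\<dots> = (\<integral>\<^sup>+z. ennreal (1 / (4 * pi)) * c z \<partial>?M)"
    by (subst nn_integral_density) simp_all
  also have "\<dots> = (\<integral>\<^sup>+\<eta>. \<integral>\<^sup>+y. ennreal (1 / (4 * pi)) * c (\<eta>, y)
      \<partial>(\<gamma> \<Otimes>\<^sub>M (\<gamma> \<Otimes>\<^sub>M sphere_measure)) \<partial>\<mu>)"
    by (rule G2.nn_integral_fst[symmetric]) simp
  also have "\<dots> = (\<integral>\<^sup>+\<eta>. \<integral>\<^sup>+p. \<integral>\<^sup>+y. ennreal (1 / (4 * pi)) * c (\<eta>, p, y)
      \<partial>(\<gamma> \<Otimes>\<^sub>M sphere_measure) \<partial>\<gamma> \<partial>\<mu>)"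
    by (intro nn_integral_cong G1.nn_integral_fst[symmetric]) measurable
  also have "\<dots> = (\<integral>\<^sup>+\<eta>. \<integral>\<^sup>+p. \<integral>\<^sup>+q. \<integral>\<^sup>+\<sigma>. ennreal (1 / (4 * pi)) * c (\<eta>, p, q, \<sigma>)
      \<partial>sphere_measure \<partial>\<gamma> \<partial>\<gamma> \<partial>\<mu>)"
    by (intro nn_integral_cong S.nn_integral_fst[symmetric]) measurable
  also have "\<dots> = (\<integral>\<^sup>+\<eta>. \<integral>\<^sup>+p. \<integral>\<^sup>+q. ennreal (1 / (4 * pi)) *
      (\<integral>\<^sup>+\<sigma>. c (\<eta>, p, q, \<sigma>) \<partial>sphere_measure) \<partial>\<gamma> \<partial>\<gamma> \<partial>\<mu>)"
    by (intro nn_integral_cong nn_integral_cmult) measurable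
  also have "\<dots> \<le> (\<integral>\<^sup>+\<eta>. \<integral>\<^sup>+p. \<integral>\<^sup>+q. ennreal (P \<eta> p q) \<partial>\<gamma> \<partial>\<gamma> \<partial>\<mu>)"
  proof (intro nn_integral_mono)
    fix \<eta> p q
    have "ennreal (1 / (4 * pi)) * (\<integral>\<^sup>+\<sigma>. c (\<eta>, p, q, \<sigma>) \<partial>sphere_measure)
        \<le> ennreal (1 / (4 * pi)) * ennreal (4 * pi * P \<eta> p q)"
      using nn_integral_sphere_post_velocity_le[of "e + \<eta>" "fst p" "fst q" "snd p" "snd q"]
      unfolding c_def P_def by (intro mult_left_mono) simp_all
    also have "\<dots> = ennreal (P \<eta> p q)"
      by (simp flip: ennreal_mult')
    finally show "ennreal (1 / (4 * pi)) * (\<integral>\<^sup>+\<sigma>. c (\<eta>, p, q, \<sigma>) \<partial>sphere_measure) \<le> ennreal (P \<eta> p q)" .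
  qed
  also have "\<dots> = (\<integral>\<^sup>+\<eta>. \<integral>\<^sup>+pq. ennreal (P \<eta> (fst pq) (snd pq)) \<partial>(\<gamma> \<Otimes>\<^sub>M \<gamma>) \<partial>\<mu>)"
    by (subst \<gamma>.nn_integral_fst[symmetric]) (auto simp: P_def cong: nn_integral_cong)
  also have "\<dots> = (\<integral>\<^sup>+pq. \<integral>\<^sup>+\<eta>. ennreal (P \<eta> (fst pq) (snd pq)) \<partial>\<mu> \<partial>(\<gamma> \<Otimes>\<^sub>M \<gamma>))"
    by (rule M.Fubini'[symmetric]) (use P_meas in \<open>simp add: case_prod_beta'\<close>)
  also have "\<dots> = (\<integral>\<^sup>+pq. ennreal ((3 - e) / 4) * ennreal ((norm (?d (fst pq)))\<^sup>2)
      + ennreal ((1 + e) / 4) * ennreal ((norm (?d (snd pq)))\<^sup>2) \<partial>(\<gamma> \<Otimes>\<^sub>M \<gamma>))"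
    unfolding P_def nn_integral_fluctuation_law[OF law \<beta>] using assms(1,2)
    by (simp flip: ennreal_mult')
  also have "\<dots> = ennreal ((3 - e) / 4) * ?K + ennreal ((1 + e) / 4) * ?K"
    by (subst \<gamma>.nn_integral_fst[symmetric], measurable)
       (simp add: nn_integral_add nn_integral_cmult \<gamma>.emeasure_space_1)
  also have "\<dots> = ennreal ((3 - e) / 4 + (1 + e) / 4) * ?K"
    using assms(1,2) by (subst ennreal_plus) (auto simp: distrib_right)
  also have "(3 - e) / 4 + (1 + e) / 4 = (1 :: real)"
    by (simp add: field_simps)
  finally show ?thesis
    by (simp add: case_prod_beta')
qed

lemma ennreal_sqrt_mono: "ennreal_sqrt a \<le> ennreal_sqrt b" if "a \<le> b"
proof (cases "b = \<infinity>")
  case False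
  then have "b < top"
    by (simp add: top.not_eq_extremum)
  moreover from this that have "a < top"
    by (rule le_less_trans[rotated])
  ultimately show ?thesis
    using that by (auto simp: ennreal_sqrt_def intro!: ennreal_leI enn2real_mono)
qed (simp add: ennreal_sqrt_def)

theorem theorem5p1:
  fixes e \<beta> :: real and \<mu> :: "real measure" and f g :: "(real^3) measure"
  assumes "0 \<le> e" and "e \<le> 1"
    and "fluctuation_law e \<beta> \<mu>"
    and "\<beta>\<^sup>2 = 1 - e\<^sup>2"
    and "f \<in> P2" and "g \<in> P2"
    and "mean_velocity f = mean_velocity g"
  shows "W2 (gain e \<mu> f f) (gain e \<mu> g g) \<le> W2 f g"
  unfolding W2_def
proof (rule INF_mono)
  fix \<gamma> assume \<gamma>: "\<gamma> \<in> couplings f g"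
  have \<mu>: "prob_space \<mu>" "sets \<mu> = sets borel"
    using assms(3) by (auto simp: fluctuation_law_def)
  have "prob_space \<gamma>" "sets \<gamma> = sets borel"
    using \<gamma> by (auto simp: couplings_def)
  from collision_coupling_cost_le[OF assms(1-4) this] collision_coupling_in_couplings[OF \<mu> \<gamma>]
  show "\<exists>\<Gamma>\<in>couplings (gain e \<mu> f f) (gain e \<mu> g g).
      ennreal_sqrt (\<integral>\<^sup>+(v, x). ennreal ((norm (v - x))\<^sup>2) \<partial>\<Gamma>)
        \<le> ennreal_sqrt (\<integral>\<^sup>+(v, x). ennreal ((norm (v - x))\<^sup>2) \<partial>\<gamma>)"
    by (intro bexI ennreal_sqrt_mono)
qed

end
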